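(* Let $a=a_1,a_2,\ldots,a_n$ be a feasible sequence. Form the sequence $\hat a=\hat a_2,\hat a_3,\ldots,\hat a_n$ (indexed by $2,\dots,n$) by deleting $a_1$ and adding $1$ to each of the $a_1$ smallest elements among $a_2,\ldots,a_n$ (leaving the other entries unchanged), where $a_i$ is considered smaller than $a_j$ if $a_i<a_j$, or if $a_i=a_j$ and $i<j$. Then $\hat a$ is well defined (i.e. $0\le a_1\le n-1$) and is feasible, that is: $\hat a$ is non-increasing, $\sum_{i=2}^n \hat a_i=0$, and $\sum_{i=2}^k \hat a_i\le (k-1)(n-k)$ for all $2\le k\le n$.
   Context: A non-increasing sequence of integers $c=c_1,c_2,\ldots,c_N$ is called feasible if $\sum_{i=1}^N c_i=0$ and $\sum_{i=1}^k c_i\le k(N-k)$ for all $1\le k\le N$. (For the sequence $\hat a$ of length $N=n-1$ indexed from $2$ to $n$, this is the condition stated in the claim.) *)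

theory Defs
  imports Complex_Main
begin

text \<open>A sequence \<open>c\<^sub>1, \<dots>, c\<^sub>N\<close> is a function on \<open>nat\<close>, of which only the values on \<open>{1..N}\<close> matter.\<close>

definition feasible :: "nat \<Rightarrow> (nat \<Rightarrow> int) \<Rightarrow> bool" where
  "feasible N c \<longleftrightarrow>
     antimono_on {1..N} c \<and>
     (\<Sum>i=1..N. c i) = 0 \<and>
     (\<forall>k\<in>{1..N}. (\<Sum>i=1..k. c i) \<le> int k * (int N - int k))"

definition smaller :: "(nat \<Rightarrow> int) \<Rightarrow> nat \<Rightarrow> nat \<Rightarrow> bool" where
  "smaller a i j \<longleftrightarrow> a i < a j \<or> (a i = a j \<and> i < j)"

text \<open>The positions in \<open>A\<close> of the \<open>m\<close> smallest elements: those with fewer than \<open>m\<close> elements below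
  them. The two lemmas below confirm that, if \<open>m \<le> card A\<close>, there are exactly \<open>m\<close> such positions and
  that their elements are smaller than all the remaining ones.\<close>

definition smallest :: "(nat \<Rightarrow> int) \<Rightarrow> nat set \<Rightarrow> nat \<Rightarrow> nat set" where
  "smallest a A m = {i \<in> A. card {j \<in> A. smaller a j i} < m}"

lemma smaller_rank_less:
  assumes "finite A" "i \<in> A" "smaller a i j"
  shows "card {l \<in> A. smaller a l i} < card {l \<in> A. smaller a l j}"
proof (rule psubset_card_mono)
  show "finite {l \<in> A. smaller a l j}" using assms by simp
  have "{l \<in> A. smaller a l i} \<subseteq> {l \<in> A. smaller a l j}"
    using assms by (auto simp: smaller_def)
  moreover have "i \<in> {l \<in> A. smaller a l j}" "i \<notin> {l \<in> A. smaller a l i}"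
    using assms by (auto simp: smaller_def)
  ultimately show "{l \<in> A. smaller a l i} \<subset> {l \<in> A. smaller a l j}" by blast
qed

lemma smallest_smaller:
  assumes "finite A" "i \<in> smallest a A m" "j \<in> A - smallest a A m"
  shows "smaller a i j"
proof (rule ccontr)
  assume "\<not> smaller a i j"
  then have "smaller a j i \<or> i = j" by (auto simp: smaller_def)
  then show False
    using assms smaller_rank_less[of A j a i] by (auto simp: smallest_def)
qed

lemma card_smallest:
  assumes "finite A" "m \<le> card A"
  shows "card (smallest a A m) = m"
proof -
  define r where "r i = card {j \<in> A. smaller a j i}" for i
  have inj: "inj_on r A"
  proof (rule inj_onI)
    fix i j assume ij: "i \<in> A" "j \<in> A" "r i = r j"
    have "smaller a i j \<or> smaller a j i \<or> i = j" by (auto simp: smaller_def)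
    then show "i = j"
      using ij smaller_rank_less[OF assms(1), of i a j] smaller_rank_less[OF assms(1), of j a i]
      unfolding r_def by linarith
  qed
  have "r i < card A" if "i \<in> A" for i
    unfolding r_def
  proof (rule psubset_card_mono[OF assms(1)])
    have "i \<notin> {j \<in> A. smaller a j i}" by (simp add: smaller_def)
    then show "{j \<in> A. smaller a j i} \<subset> A" using that by blast
  qed
  then have "r ` A \<subseteq> {..<card A}" by auto
  then have im: "r ` A = {..<card A}"
    using card_image[OF inj] by (intro card_subset_eq) auto
  have "r ` smallest a A m = {..<m}"
  proof
    show "r ` smallest a A m \<subseteq> {..<m}" by (auto simp: smallest_def r_def)
    show "{..<m} \<subseteq> r ` smallest a A m"
    proof
      fix x assume x: "x \<in> {..<m}"
      then have "x \<in> r ` A" using im assms(2) by auto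
      then obtain i where "i \<in> A" "x = r i" by blast
      then show "x \<in> r ` smallest a A m" using x by (auto simp: smallest_def r_def)
    qed
  qed
  moreover have "inj_on r (smallest a A m)"
    by (rule inj_on_subset[OF inj]) (auto simp: smallest_def)
  ultimately show ?thesis using card_image[of r "smallest a A m"] by simp
qed

text \<open>Only the values on \<open>{2..n}\<close> matter; meaningful when \<open>0 \<le> a 1 \<le> n - 1\<close>.\<close>

definition hat :: "nat \<Rightarrow> (nat \<Rightarrow> int) \<Rightarrow> nat \<Rightarrow> int" where
  "hat n a i = (if i \<in> smallest a {2..n} (nat (a 1)) then a i + 1 else a i)"

end

theory Submission
  imports Defs
begin

text \<open>Let \<open>S\<close> be the set of increased positions and let \<open>D k\<close> be the slack
  \<open>(k - 1) (n - k) - (\<Sum>i=2..k. hat n a i)\<close>. If \<open>S\<close> lies to the right of \<open>k\<close>, or contains everything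
  to the right of \<open>k\<close>, then \<open>D k \<ge> 0\<close> follows directly from the feasibility of \<open>a\<close>. Otherwise some
  position \<open>i \<le> k\<close> is in \<open>S\<close> while some \<open>j > k\<close> is not, which forces \<open>a\<close> to be constant on \<open>{i..j}\<close>,
  so \<open>hat n a\<close> drops by at most 1 from \<open>k\<close> to \<open>k + 1\<close>. As the increments of \<open>(k - 1) (n - k)\<close> drop
  by 2, \<open>D\<close> is strictly concave at \<open>k\<close> and thus has no minimum there.\<close>

text \<open>\<open>a 1\<close> is the largest entry and the entries sum to 0, so
  \<open>n * a 1 \<ge> 0\<close>; the upper bound is the feasibility inequality at
  \<open>k = 1\<close>.\<close>

lemma feasible_first_bounds:
  assumes "n \<ge> 1" "feasible n a"
  shows "0 \<le> a 1" "a 1 \<le> int n - 1"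
proof -
  have "(\<Sum>i=1..n. a i) \<le> of_nat (card {1..n}) * a 1"
    using assms by (intro sum_bounded_above) (auto simp: feasible_def monotone_on_def)
  then show "0 \<le> a 1"
    using assms by (simp add: feasible_def zero_le_mult_iff)
  have "(\<Sum>i=1..1. a i) \<le> int 1 * (int n - int 1)"
    using assms unfolding feasible_def by (metis atLeastAtMost_iff order_refl)
  then show "a 1 \<le> int n - 1" by simp
qed

text \<open>Order could fail only if \<open>j\<close> is increased and an earlier \<open>i\<close>
  is not. Then \<open>j\<close> counts as smaller than \<open>i\<close>; as ties make the lower
  index smaller, \<open>a j < a i\<close> is strict, which leaves room for the 1.\<close>

lemma antimono_on_hat:
  assumes "antimono_on {1..n} a"
  shows "antimono_on {2..n} (hat n a)"
proof (rule monotone_onI)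
  fix i j assume ij: "i \<in> {2..n}" "j \<in> {2..n}" "i \<le> j"
  let ?S = "smallest a {2..n} (nat (a 1))"
  have le: "a j \<le> a i" using assms ij by (auto simp: monotone_on_def)
  have "a j < a i" if "j \<in> ?S" "i \<notin> ?S"
    using smallest_smaller[of "{2..n}" j a "nat (a 1)" i] that ij le by (auto simp: smaller_def)
  then show "hat n a i \<ge> hat n a j"
    using le by (auto simp: hat_def)
qed

lemma sum_hat:
  assumes "finite A"
  shows "(\<Sum>i\<in>A. hat n a i) = (\<Sum>i\<in>A. a i) + int (card (A \<inter> smallest a {2..n} (nat (a 1))))"
proof -
  have "(\<Sum>i\<in>A. hat n a i)
      = (\<Sum>i\<in>A. a i + (if i \<in> smallest a {2..n} (nat (a 1)) then 1 else 0))"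
    by (intro sum.cong) (auto simp: hat_def)
  also have "\<dots> = (\<Sum>i\<in>A. a i) + int (card (A \<inter> smallest a {2..n} (nat (a 1))))"
    using assms by (simp add: sum.distrib flip: sum.inter_restrict)
  finally show ?thesis .
qed

lemma card_increased_positions:
  assumes "n \<ge> 1" "feasible n a"
  shows "int (card (smallest a {2..n} (nat (a 1)))) = a 1"
  using card_smallest[of "{2..n}" "nat (a 1)" a] feasible_first_bounds[OF assms] by simp

text \<open>Deleting \<open>a 1\<close> lowers the total by \<open>a 1\<close>, and the
  \<open>a 1\<close> increments restore it.\<close>

lemma sum_hat_eq_0:
  assumes "n \<ge> 1" "feasible n a"
  shows "(\<Sum>i=2..n. hat n a i) = 0"
proof -
  let ?S = "smallest a {2..n} (nat (a 1))"
  have "{2..n} \<inter> ?S = ?S" by (auto simp: smallest_def)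
  moreover have "(\<Sum>i=1..n. a i) = a 1 + (\<Sum>i=2..n. a i)"
    using assms by (simp add: sum.atLeast_Suc_atMost numeral_2_eq_2)
  ultimately show ?thesis
    using assms card_increased_positions[OF assms] by (simp add: sum_hat feasible_def)
qed

text \<open>The \<open>a 1\<close> increased positions all fit into \<open>{k<..n}\<close>, so
  \<open>a 1 \<le> n - k\<close>; the \<open>k - 1\<close> entries in \<open>{2..k}\<close> are
  unchanged and at most \<open>a 1\<close>.\<close>

lemma sum_hat_le_if_unchanged_up_to:
  assumes "n \<ge> 1" "feasible n a" "k \<in> {1..n}"
    and "smallest a {2..n} (nat (a 1)) \<subseteq> {k<..n}"
  shows "(\<Sum>i=2..k. hat n a i) \<le> (int k - 1) * (int n - int k)"
proof -
  have "card (smallest a {2..n} (nat (a 1))) \<le> card {k<..n}"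
    by (rule card_mono) (use assms in auto)
  then have "a 1 \<le> int n - int k"
    using assms(3) card_increased_positions[OF assms(1,2)]
    by (metis atLeastAtMost_iff card_greaterThanAtMost of_nat_diff of_nat_le_iff)
  have "(\<Sum>i=2..k. hat n a i) = (\<Sum>i=2..k. a i)"
    using assms by (intro sum.cong) (auto simp: hat_def)
  also have "\<dots> \<le> of_nat (card {2..k}) * a 1"
    using assms by (intro sum_bounded_above) (auto simp: feasible_def monotone_on_def)
  also have "\<dots> = (int k - 1) * a 1"
    using assms by simp
  also have "\<dots> \<le> (int k - 1) * (int n - int k)"
    using assms \<open>a 1 \<le> int n - int k\<close> by (intro mult_left_mono) auto
  finally show ?thesis .
qed

text \<open>As the total is 0, the prefix sum is minus the sum beyond \<open>k\<close>, where each
  of the \<open>n - k\<close> entries rises by 1. So the bound \<open>k * (n - k)\<close> for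
  \<open>a\<close> drops by \<open>n - k\<close>.\<close>

lemma sum_hat_le_if_increased_after:
  assumes "n \<ge> 1" "feasible n a" "k \<in> {1..n}"
    and "{k<..n} \<subseteq> smallest a {2..n} (nat (a 1))"
  shows "(\<Sum>i=2..k. hat n a i) \<le> (int k - 1) * (int n - int k)"
proof -
  have split: "(\<Sum>i=m..n. f i) = (\<Sum>i=m..k. f i) + (\<Sum>i\<in>{k<..n}. f i)"
    if "m \<le> Suc k" for f :: "nat \<Rightarrow> int" and m
  proof -
    have "{m..n} = {m..k} \<union> {k<..n}" using that assms(3) by auto
    moreover have "{m..k} \<inter> {k<..n} = {}" by auto
    ultimately show ?thesis by (metis finite_atLeastAtMost finite_greaterThanAtMost sum.union_disjoint)
  qed
  have "(\<Sum>i=2..k. hat n a i) = - (\<Sum>i\<in>{k<..n}. hat n a i)"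
    using split[of 2 "hat n a"] sum_hat_eq_0[OF assms(1,2)] assms(3) by simp
  also have "(\<Sum>i\<in>{k<..n}. hat n a i) = (\<Sum>i\<in>{k<..n}. a i) + (int n - int k)"
    using assms by (simp add: sum_hat Int_absorb2)
  also have "(\<Sum>i\<in>{k<..n}. a i) = - (\<Sum>i=1..k. a i)"
    using split[of 1 a] assms by (simp add: feasible_def)
  finally have "(\<Sum>i=2..k. hat n a i) = (\<Sum>i=1..k. a i) - (int n - int k)" by simp
  moreover have "(\<Sum>i=1..k. a i) \<le> int k * (int n - int k)"
    using assms unfolding feasible_def by blast
  ultimately show ?thesis by (simp add: algebra_simps)
qed

lemma sum_hat_le:
  assumes "n \<ge> 1" "feasible n a" "k \<in> {1..n}"
  shows "(\<Sum>i=2..k. hat n a i) \<le> (int k - 1) * (int n - int k)"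
proof -
  let ?S = "smallest a {2..n} (nat (a 1))"
  define D where "D k = (int k - 1) * (int n - int k) - (\<Sum>i=2..k. hat n a i)" for k
  define M where "M = Min (D ` {1..n})"
  have M_le: "M \<le> D l" if "l \<in> {1..n}" for l
    using that by (simp add: M_def)
  have "M \<in> D ` {1..n}" unfolding M_def by (rule Min_in) (use assms in auto)
  then have ex: "\<exists>k. k \<in> {1..n} \<and> D k = M" by auto
  define k0 where "k0 = (LEAST k. k \<in> {1..n} \<and> D k = M)"
  have k0: "k0 \<in> {1..n}" "D k0 = M"
    using LeastI_ex[OF ex] by (auto simp: k0_def)
  have before: "M < D l" if "l \<in> {1..n}" "l < k0" for l
    using M_le[OF that(1)] not_less_Least[of l "\<lambda>k. k \<in> {1..n} \<and> D k = M"] that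
    by (auto simp: k0_def order_less_le)
  have "0 \<le> D k0"
  proof (rule ccontr)
    assume neg: "\<not> 0 \<le> D k0"
    then have "\<not> ?S \<subseteq> {k0<..n}" "\<not> {k0<..n} \<subseteq> ?S"
      using sum_hat_le_if_unchanged_up_to[OF assms(1,2) k0(1)]
        sum_hat_le_if_increased_after[OF assms(1,2) k0(1)] by (auto simp: D_def)
    then obtain i j where i: "i \<in> ?S" "i \<notin> {k0<..n}" and j: "j \<in> {k0<..n}" "j \<notin> ?S"
      by blast
    have i': "2 \<le> i" "i \<le> k0" using i by (auto simp: smallest_def)
    have j': "k0 < j" "j \<le> n" using j by auto
    have anti: "a y \<le> a x" if "1 \<le> x" "x \<le> y" "y \<le> n" for x y
      using assms(2) that by (auto simp: feasible_def monotone_on_def)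
    have "smaller a i j"
      by (rule smallest_smaller[of "{2..n}" _ _ "nat (a 1)"]) (use i j i' j' in auto)
    \<comment> \<open>\<open>smaller a i j\<close> gives \<open>a i \<le> a j\<close>, while
      \<open>a\<close> is non-increasing, so all entries from \<open>i\<close> to \<open>j\<close>
      agree.\<close>
    then have "a k0 = a (Suc k0)"
      using anti[of i k0] anti[of k0 "Suc k0"] anti[of "Suc k0" j] i' j'
      by (auto simp: smaller_def)
    then have drop: "hat n a k0 - hat n a (Suc k0) \<le> 1" by (auto simp: hat_def)
    obtain l where l: "k0 = Suc l" "1 \<le> l" using i' by (cases k0) auto
    \<comment> \<open>Minimality makes the second difference of \<open>D\<close> at
      \<open>k0\<close> positive, but it equals
      \<open>hat n a k0 - hat n a (Suc k0) - 2 \<le> -1\<close>.\<close>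
    have "D k0 < D l" "D k0 \<le> D (Suc k0)"
      using before[of l] M_le[of "Suc k0"] k0 l j' by auto
    moreover have "D (Suc k0) - D k0 = int n - 2 * int k0 - hat n a (Suc k0)"
      using l by (simp add: D_def algebra_simps)
    moreover have "D k0 - D l = int n - 2 * int k0 + 2 - hat n a k0"
      using l by (simp add: D_def algebra_simps)
    ultimately show False using drop by linarith
  qed
  then have "0 \<le> D k" using M_le[OF assms(3)] k0 by simp
  then show ?thesis by (simp add: D_def)
qed

theorem theorem3:
  fixes n :: nat and a :: "nat \<Rightarrow> int"
  assumes "n \<ge> 1"
    and "feasible n a"
  shows "0 \<le> a 1 \<and> a 1 \<le> int n - 1 \<and>
         feasible (n - 1) (\<lambda>i. hat n a (i + 1)) \<and>
         antimono_on {2..n} (hat n a) \<and>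
         (\<Sum>i=2..n. hat n a i) = 0 \<and>
         (\<forall>k\<in>{2..n}. (\<Sum>i=2..k. hat n a i) \<le> (int k - 1) * (int n - int k))"
proof -
  have anti: "antimono_on {2..n} (hat n a)"
    using assms antimono_on_hat by (auto simp: feasible_def)
  have shift: "(\<Sum>i=1..k. hat n a (i + 1)) = (\<Sum>i=2..Suc k. hat n a i)" for k
    using sum.shift_bounds_cl_Suc_ivl[of "hat n a" 1 k] by (simp add: numeral_2_eq_2)
  have "feasible (n - 1) (\<lambda>i. hat n a (i + 1))"
    unfolding feasible_def
  proof (intro conjI ballI)
    show "antimono_on {1..n - 1} (\<lambda>i. hat n a (i + 1))"
      using anti by (auto simp: monotone_on_def)
    show "(\<Sum>i=1..n - 1. hat n a (i + 1)) = 0"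
      using assms sum_hat_eq_0 by (simp only: shift) simp
    \<comment> \<open>The prefix \<open>{1..k}\<close> corresponds to \<open>{2..Suc k}\<close>, and
      the bound at \<open>Suc k\<close> is \<open>k * (n - Suc k)\<close>.\<close>
    fix k assume "k \<in> {1..n - 1}"
    then show "(\<Sum>i=1..k. hat n a (i + 1)) \<le> int k * (int (n - 1) - int k)"
      using sum_hat_le[OF assms, of "Suc k"] assms(1)
      by (simp only: shift) (auto simp: of_nat_diff algebra_simps)
  qed
  then show ?thesis
    using feasible_first_bounds[OF assms] anti sum_hat_eq_0[OF assms] sum_hat_le[OF assms] by auto
qed

end
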